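(* $$I(X(\mathbb{F}_q))=I(\mathbb{A}^r_G(\mathbb{F}_q)):B .$$
   Context: Let $\mathbb{F}_q$ be a finite field, $\mathbb{K}=\overline{\mathbb{F}}_q$ an algebraic closure, and $X=X_\Sigma$ an $n$-dimensional simplicial complete toric variety over $\mathbb{K}$ with fan $\Sigma$ in $\mathbb{R}^n$, whose rays $\rho_1,\dots,\rho_r$ have primitive generators $\mathbf{v}_1,\dots,\mathbf{v}_r\in\mathbb{Z}^n$. Let $\phi$ be the $r\times n$ matrix with rows $\mathbf{v}_i$; it is assumed that there is a short exact sequence $0\to\mathbb{Z}^n\xrightarrow{\phi}\mathbb{Z}^r\xrightarrow{\beta}\mathbb{Z}^d\to0$ ($d=r-n$) with $\beta=[\beta_1\cdots\beta_r]$ a $d\times r$ matrix of rank $d$ with non-negative integer entries. Let $S=\mathbb{F}_q[x_1,\dots,x_r]$, $\mathbb{Z}^d$-graded by $\deg_\beta(x_j)=\beta_j$ (the graded pieces $S_\alpha$ are finite-dimensional); "homogeneous" refers to this grading. Let $L_\beta=\mathrm{Ker}(\beta)\subseteq\mathbb{Z}^r$ and $G=\{P\in(\mathbb{K}^* )^r:\mathbf{x}^{\mathbf{m}}(P)=1\text{ for all }\mathbf{m}\in L_\beta\}$, acting on $\mathbb{K}^r$ by coordinatewise multiplication. $B=\langle\mathbf{x}^{\hat\sigma}=\prod_{\rho_i\not\subset\sigma}x_i:\sigma\in\Sigma\rangle\subset S$, where the product is over the rays $\rho_i$ that are not rays of $\sigma$, with zero set $V(B)\subseteq\mathbb{K}^r$.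 $\mathbb{A}^r_G(\mathbb{F}_q)=\mathbb{F}_q^r/G$ is the set of $G$-orbits $[P]=G\cdot P$ of points $P\in\mathbb{F}_q^r$, and $X(\mathbb{F}_q)$ is identified with the set of orbits $[P]$ with $P\in\mathbb{F}_q^r\setminus V(B)$. For a set $Y_G$ of orbits, $I(Y_G)\subseteq S$ is the ideal generated by the homogeneous polynomials in $S$ vanishing at all $P$ with $[P]\in Y_G$ (for homogeneous $F$, vanishing at $P$ depends only on $[P]$). For ideals, $J:B=\{F\in S:FF'\in J\text{ for all }F'\in B\}$. *)

theory Defs
  imports
    "HOL-Analysis.Analysis"
    "HOL-Library.Poly_Mapping"
    "HOL-Algebra.Algebraic_Closure_Type"
begin

no_notation fps_nth (infixl "$" 75)

section \<open>Simplicial complete fans\<close>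

text \<open>Cones live in \<open>real ^ 'n\<close>, with lattice the integer vectors.\<close>

definition real_vec :: "int ^ 'n \<Rightarrow> real ^ 'n" where
  "real_vec v = (\<chi> i. real_of_int (v $ i))"

definition rational_polyhedral_cone :: "(real ^ 'n) set \<Rightarrow> bool" where
  "rational_polyhedral_cone \<sigma> \<longleftrightarrow>
     (\<exists>A :: (int ^ 'n) set. finite A \<and> \<sigma> = convex_cone hull (real_vec ` A))"

definition strongly_convex :: "(real ^ 'n) set \<Rightarrow> bool" where
  "strongly_convex \<sigma> \<longleftrightarrow> \<sigma> \<inter> uminus ` \<sigma> = {0}"

text \<open>The library relation \<open>face_of\<close> counts the empty set as a face; faces of a cone in the
  sense of fans are the nonempty ones.\<close>

definition is_fan :: "(real ^ 'n) set set \<Rightarrow> bool" where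
  "is_fan \<Sigma> \<longleftrightarrow>
     finite \<Sigma> \<and>
     (\<forall>\<sigma>\<in>\<Sigma>. rational_polyhedral_cone \<sigma> \<and> strongly_convex \<sigma>) \<and>
     (\<forall>\<sigma>\<in>\<Sigma>. \<forall>\<tau>. \<tau> face_of \<sigma> \<and> \<tau> \<noteq> {} \<longrightarrow> \<tau> \<in> \<Sigma>) \<and>
     (\<forall>\<sigma>\<in>\<Sigma>. \<forall>\<tau>\<in>\<Sigma>. \<sigma> \<inter> \<tau> face_of \<sigma> \<and> \<sigma> \<inter> \<tau> face_of \<tau>)"

definition simplicial_fan :: "(real ^ 'n) set set \<Rightarrow> bool" where
  "simplicial_fan \<Sigma> \<longleftrightarrow>
     (\<forall>\<sigma>\<in>\<Sigma>. \<exists>A. finite A \<and> independent A \<and> \<sigma> = convex_cone hull A)"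

definition complete_fan :: "(real ^ 'n) set set \<Rightarrow> bool" where
  "complete_fan \<Sigma> \<longleftrightarrow> \<Union> \<Sigma> = UNIV"

definition ray :: "int ^ 'n \<Rightarrow> (real ^ 'n) set" where
  "ray v = convex_cone hull {real_vec v}"

definition primitive :: "int ^ 'n \<Rightarrow> bool" where
  "primitive v \<longleftrightarrow> Gcd (range (($) v)) = 1"

text \<open>The rows of \<open>\<phi>\<close> are the primitive generators of the rays of \<open>\<Sigma>\<close>, the \<open>i\<close>-th ray
  being \<open>ray (\<phi> $ i)\<close>; every ray is listed exactly once.\<close>

definition ray_matrix :: "(real ^ 'n) set set \<Rightarrow> int ^ 'n ^ 'r \<Rightarrow> bool" where
  "ray_matrix \<Sigma> \<phi> \<longleftrightarrow>
     (\<forall>i. primitive (\<phi> $ i)) \<and>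
     bij_betw (\<lambda>i. ray (\<phi> $ i)) UNIV {\<rho> \<in> \<Sigma>. dim \<rho> = 1}"

definition short_exact :: "int ^ 'n ^ 'r \<Rightarrow> int ^ 'r ^ 'd \<Rightarrow> bool" where
  "short_exact \<phi> \<beta> \<longleftrightarrow>
     inj ((*v) \<phi>) \<and> range ((*v) \<phi>) = {u. \<beta> *v u = 0} \<and> surj ((*v) \<beta>)"

section \<open>The graded polynomial ring\<close>

type_synonym ('r, 'a) mvpoly = "('r \<Rightarrow>\<^sub>0 nat) \<Rightarrow>\<^sub>0 'a"

definition var :: "'r \<Rightarrow> ('r, 'a::comm_ring_1) mvpoly" where
  "var i = Poly_Mapping.single (Poly_Mapping.single i 1) 1"

text \<open>Evaluation of a polynomial over \<open>'f\<close> at a point with coordinates in the algebraic closure.\<close>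

definition eval_poly ::
    "('r::finite, 'f::field) mvpoly \<Rightarrow> 'f alg_closure ^ 'r \<Rightarrow> 'f alg_closure" where
  "eval_poly F P =
     (\<Sum>m\<in>Poly_Mapping.keys F. to_ac (Poly_Mapping.lookup F m) *
        (\<Prod>i\<in>UNIV. (P $ i) ^ Poly_Mapping.lookup m i))"

definition monom_degree :: "int ^ 'r ^ 'd \<Rightarrow> ('r \<Rightarrow>\<^sub>0 nat) \<Rightarrow> int ^ 'd" where
  "monom_degree \<beta> m = \<beta> *v (\<chi> i. int (Poly_Mapping.lookup m i))"

definition graded_piece ::
    "int ^ 'r ^ 'd \<Rightarrow> int ^ 'd \<Rightarrow> ('r, 'f::comm_ring_1) mvpoly set" where
  "graded_piece \<beta> \<alpha> = {F. \<forall>m\<in>Poly_Mapping.keys F. monom_degree \<beta> m = \<alpha>}"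

definition homogeneous :: "int ^ 'r ^ 'd \<Rightarrow> ('r, 'f::comm_ring_1) mvpoly \<Rightarrow> bool" where
  "homogeneous \<beta> F \<longleftrightarrow> (\<exists>\<alpha>. F \<in> graded_piece \<beta> \<alpha>)"

text \<open>The ideal generated by a set is its span in the ring regarded as a module over itself.\<close>

definition ideal_gen :: "'a::comm_ring_1 set \<Rightarrow> 'a set" where
  "ideal_gen A = Modules.module.span (*) A"

lemma module_times: "Modules.module ((*) :: 'a::comm_ring_1 \<Rightarrow> 'a \<Rightarrow> 'a)"
  by unfold_locales (simp_all add: algebra_simps)

definition ideal_colon :: "'a::comm_ring_1 set \<Rightarrow> 'a set \<Rightarrow> 'a set" where
  "ideal_colon J B = {F. \<forall>F'\<in>B. F * F' \<in> J}"

section \<open>Torus orbits and rational points\<close>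

definition kernel_lattice :: "int ^ 'r ^ 'd \<Rightarrow> (int ^ 'r) set" where
  "kernel_lattice \<beta> = {m. \<beta> *v m = 0}"

definition torus_group :: "int ^ 'r ^ 'd \<Rightarrow> ('f::field alg_closure ^ 'r) set" where
  "torus_group \<beta> = {P. (\<forall>i. P $ i \<noteq> 0) \<and>
     (\<forall>m\<in>kernel_lattice \<beta>. (\<Prod>i\<in>UNIV. (P $ i) powi (m $ i)) = 1)}"

text \<open>Multiplication of vectors is coordinatewise.\<close>

definition torus_orbit ::
    "int ^ 'r ^ 'd \<Rightarrow> 'f::field alg_closure ^ 'r \<Rightarrow> ('f alg_closure ^ 'r) set" where
  "torus_orbit \<beta> P = (\<lambda>g. g * P) ` torus_group \<beta>"

definition rational_points :: "('f::field alg_closure ^ 'r) set" where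
  "rational_points = {P. \<forall>i. P $ i \<in> range to_ac}"

text \<open>In a fan, \<open>ray (\<phi> $ i) \<subseteq> \<sigma>\<close> holds exactly when that ray is a face of \<open>\<sigma>\<close>.\<close>

definition cone_monomial ::
    "int ^ 'n ^ 'r \<Rightarrow> (real ^ 'n) set \<Rightarrow> ('r::finite, 'f::comm_ring_1) mvpoly" where
  "cone_monomial \<phi> \<sigma> = (\<Prod>i\<in>{i. \<not> ray (\<phi> $ i) \<subseteq> \<sigma>}. var i)"

definition irrelevant_ideal ::
    "(real ^ 'n) set set \<Rightarrow> int ^ 'n ^ 'r \<Rightarrow> ('r::finite, 'f::comm_ring_1) mvpoly set" where
  "irrelevant_ideal \<Sigma> \<phi> = ideal_gen (cone_monomial \<phi> ` \<Sigma>)"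

definition zero_set ::
    "('r::finite, 'f::field) mvpoly set \<Rightarrow> ('f alg_closure ^ 'r) set" where
  "zero_set J = {P. \<forall>F\<in>J. eval_poly F P = 0}"

definition affine_orbits :: "int ^ 'r ^ 'd \<Rightarrow> ('f::field alg_closure ^ 'r) set set" where
  "affine_orbits \<beta> = torus_orbit \<beta> ` rational_points"

text \<open>The rational points of the toric variety, in Cox's quotient description, as the orbits
  of rational points off the zero set of the irrelevant ideal.\<close>

definition toric_rational_points ::
    "(real ^ 'n) set set \<Rightarrow> int ^ 'n ^ 'r \<Rightarrow> int ^ 'r ^ 'd \<Rightarrow>
     ('f::field alg_closure ^ 'r::finite) set set" where
  "toric_rational_points \<Sigma> \<phi> \<beta> =
     torus_orbit \<beta> ` (rational_points - zero_set (irrelevant_ideal \<Sigma> \<phi> :: ('r, 'f) mvpoly set))"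

definition vanishing_ideal ::
    "int ^ 'r ^ 'd \<Rightarrow> ('f::field alg_closure ^ 'r::finite) set set \<Rightarrow> ('r, 'f) mvpoly set" where
  "vanishing_ideal \<beta> Y =
     ideal_gen {F. homogeneous \<beta> F \<and> (\<forall>P. torus_orbit \<beta> P \<in> Y \<longrightarrow> eval_poly F P = 0)}"

end

theory Submission
  imports Defs
begin

text \<open>The fan enters only through the monomials generating \<open>B\<close>. An orbit \<open>[P]\<close> of a rational
  point lies in \<open>X\<close> exactly when one of these monomials is nonzero at \<open>P\<close>. So a homogeneous
  \<open>F\<close> vanishes on \<open>X\<close> if and only if all its products with these monomials vanish on all rational
  orbits. As \<open>I(Y)\<close> is generated by homogeneous polynomials, the homogeneous components of each
  of its elements vanish on \<open>Y\<close>; this reduces the colon ideal to homogeneous polynomials.\<close>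

text \<open>A polynomial is the finite sum of its terms, so a property stable under sums need only
  be checked on single terms.\<close>

lemma poly_mapping_induct_single [case_names single add]:
  fixes F :: "'k \<Rightarrow>\<^sub>0 'b::comm_monoid_add"
  assumes single: "\<And>k c. P (Poly_Mapping.single k c)"
    and add: "\<And>F G. P F \<Longrightarrow> P G \<Longrightarrow> P (F + G)"
  shows "P F"
proof -
  have "P (\<Sum>k\<in>A. Poly_Mapping.single k (Poly_Mapping.lookup F k))" if "finite A" for A
    using that
  proof induction
    case empty
    \<comment> \<open>The empty sum is the term with coefficient 0, at any exponent.\<close>
    show ?case using single[of undefined 0] by simp
  next
    case (insert k A)
    then show ?case by (simp add: single add)
  qed
  moreover have "(\<Sum>k\<in>Poly_Mapping.keys F. Poly_Mapping.single k (Poly_Mapping.lookup F k)) = F"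
    by (rule poly_mapping_eqI)
       (auto simp: lookup_sum lookup_single when_def in_keys_iff)
  ultimately show ?thesis by (metis finite_keys)
qed

section \<open>Evaluation\<close>

lemma eval_poly_superset:
  assumes "finite A" "Poly_Mapping.keys F \<subseteq> A"
  shows "eval_poly F P = (\<Sum>m\<in>A. to_ac (Poly_Mapping.lookup F m) *
           (\<Prod>i\<in>UNIV. (P $ i) ^ Poly_Mapping.lookup m i))"
  unfolding eval_poly_def using assms by (intro sum.mono_neutral_left) (auto simp: in_keys_iff)

lemma eval_poly_single:
  "eval_poly (Poly_Mapping.single m c) P = to_ac c * (\<Prod>i\<in>UNIV. (P $ i) ^ Poly_Mapping.lookup m i)"
  by (subst eval_poly_superset[of "{m}"]) auto

lemma eval_poly_0 [simp]: "eval_poly 0 P = 0"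
  by (simp add: eval_poly_def)

lemma eval_poly_add [simp]: "eval_poly (F + G) P = eval_poly F P + eval_poly G P"
proof -
  let ?A = "Poly_Mapping.keys F \<union> Poly_Mapping.keys G"
  have "Poly_Mapping.keys (F + G) \<subseteq> ?A" by (rule Poly_Mapping.keys_add)
  then show ?thesis
    by (simp add: eval_poly_superset[of ?A] lookup_add distrib_right sum.distrib)
qed

text \<open>Both sides are additive in \<open>F\<close> and in \<open>G\<close>, which leaves the
  product of two terms, where exponents add and coefficients multiply.\<close>

lemma eval_poly_mult [simp]: "eval_poly (F * G) P = eval_poly F P * eval_poly G P"
proof (induction F rule: poly_mapping_induct_single)
  case (single m c)
  show ?case
  proof (induction G rule: poly_mapping_induct_single)
    case (single n d)
    show ?case
      by (simp add: mult_single eval_poly_single lookup_add power_add prod.distrib mult_ac)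
  qed (simp add: distrib_left)
qed (simp add: distrib_right)

lemma eval_poly_1 [simp]: "eval_poly 1 P = 1"
  using eval_poly_single[of 0 1 P] by simp

lemma eval_poly_var: "eval_poly (var i) P = P $ i"
proof -
  have "(\<Prod>j\<in>UNIV. (P $ j) ^ Poly_Mapping.lookup (Poly_Mapping.single i 1) j)
      = (\<Prod>j\<in>UNIV. if i = j then P $ j else 1)"
    by (intro prod.cong) (auto simp: lookup_single when_def)
  then show ?thesis by (simp add: var_def eval_poly_single)
qed

lemma eval_poly_prod: "eval_poly (\<Prod>i\<in>A. f i) P = (\<Prod>i\<in>A. eval_poly (f i) P)"
  by (induction A rule: infinite_finite_induct) auto

lemma eval_cone_monomial:
  "eval_poly (cone_monomial \<phi> \<sigma>) P = (\<Prod>i\<in>{i. \<not> ray (\<phi> $ i) \<subseteq> \<sigma>}. P $ i)"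
  by (simp add: cone_monomial_def eval_poly_prod eval_poly_var)

section \<open>The grading\<close>

lemma monom_degree_add: "monom_degree \<beta> (m + n) = monom_degree \<beta> m + monom_degree \<beta> n"
  by (simp add: monom_degree_def matrix_vector_mult_def vec_eq_iff lookup_add distrib_left sum.distrib)

lemma graded_piece_mult:
  assumes "F \<in> graded_piece \<beta> \<alpha>" "G \<in> graded_piece \<beta> \<gamma>"
  shows "F * G \<in> graded_piece \<beta> (\<alpha> + \<gamma>)"
  using assms keys_mult[of F G] by (fastforce simp: graded_piece_def monom_degree_add)

lemma graded_piece_single:
  "Poly_Mapping.single m c \<in> graded_piece \<beta> (monom_degree \<beta> m)"
  by (simp add: graded_piece_def)

lemma homogeneous_mult:
  "homogeneous \<beta> F \<Longrightarrow> homogeneous \<beta> G \<Longrightarrow> homogeneous \<beta> (F * G)"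
  unfolding homogeneous_def using graded_piece_mult by blast

lemma homogeneous_single: "homogeneous \<beta> (Poly_Mapping.single m c)"
  unfolding homogeneous_def using graded_piece_single by blast

lemma homogeneous_cone_monomial:
  "homogeneous \<beta> (cone_monomial \<phi> \<sigma> :: ('r::finite, 'f::comm_ring_1) mvpoly)"
proof -
  have "homogeneous \<beta> (\<Prod>i\<in>A. var i :: ('r, 'f) mvpoly)" for A
  proof (induction A rule: infinite_finite_induct)
    case (insert i A)
    then show ?case by (simp add: homogeneous_mult var_def homogeneous_single)
  \<comment> \<open>The empty product 1 is the term with exponent 0 and coefficient 1.\<close>
  qed (use homogeneous_single[of \<beta> 0 1] in simp_all)
  then show ?thesis by (simp add: cone_monomial_def)
qed

text \<open>The projection onto the piece of degree \<alpha> along all other pieces. Every \<alpha>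
  is allowed, occurring in \<open>F\<close> or not, so degrees can be shifted freely.\<close>

definition graded_component ::
    "int ^ 'r ^ 'd \<Rightarrow> int ^ 'd \<Rightarrow> ('r, 'f::comm_ring_1) mvpoly \<Rightarrow> ('r, 'f) mvpoly" where
  "graded_component \<beta> \<alpha> F = Poly_Mapping.mapp (\<lambda>m c. c when monom_degree \<beta> m = \<alpha>) F"

lemma lookup_graded_component:
  "Poly_Mapping.lookup (graded_component \<beta> \<alpha> F) m =
     (Poly_Mapping.lookup F m when monom_degree \<beta> m = \<alpha>)"
  by (auto simp: graded_component_def lookup_mapp when_def in_keys_iff)

lemma graded_component_in_graded_piece: "graded_component \<beta> \<alpha> F \<in> graded_piece \<beta> \<alpha>"
  by (auto simp: graded_piece_def in_keys_iff lookup_graded_component)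

lemma graded_component_0 [simp]: "graded_component \<beta> \<alpha> 0 = 0"
  by (rule poly_mapping_eqI) (simp add: lookup_graded_component)

lemma graded_component_add:
  "graded_component \<beta> \<alpha> (F + G) = graded_component \<beta> \<alpha> F + graded_component \<beta> \<alpha> G"
  by (rule poly_mapping_eqI) (simp add: lookup_graded_component lookup_add when_def)

lemma graded_component_of_graded_piece:
  "F \<in> graded_piece \<beta> \<gamma> \<Longrightarrow> graded_component \<beta> \<alpha> F = (F when \<gamma> = \<alpha>)"
  by (rule poly_mapping_eqI)
     (auto simp: lookup_graded_component when_def graded_piece_def in_keys_iff)

text \<open>Multiplying by \<open>H\<close> shifts all degrees by \<gamma>, and \<gamma> cancels in
  the group of degrees, so only the terms of \<open>F\<close> of degree \<alpha> reach degree
  \<alpha> + \<gamma>.\<close>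

lemma graded_component_mult:
  assumes "H \<in> graded_piece \<beta> \<gamma>"
  shows "graded_component \<beta> (\<alpha> + \<gamma>) (F * H) = graded_component \<beta> \<alpha> F * H"
proof (induction F rule: poly_mapping_induct_single)
  case (single m c)
  have "Poly_Mapping.single m c * H \<in> graded_piece \<beta> (monom_degree \<beta> m + \<gamma>)"
    using graded_piece_mult[OF graded_piece_single assms] .
  then show ?case
    by (simp add: graded_component_of_graded_piece[OF graded_piece_single]
        graded_component_of_graded_piece when_def)
qed (simp add: distrib_right graded_component_add)

lemma sum_graded_components:
  "(\<Sum>\<alpha>\<in>monom_degree \<beta> ` Poly_Mapping.keys F. graded_component \<beta> \<alpha> F) = F"
  by (rule poly_mapping_eqI)
     (auto simp: lookup_sum lookup_graded_component when_def in_keys_iff)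

section \<open>Ideals\<close>

lemma ideal_gen_base: "F \<in> A \<Longrightarrow> F \<in> ideal_gen A"
  unfolding ideal_gen_def by (rule module.span_base[OF module_times])

lemma ideal_gen_0: "0 \<in> ideal_gen A"
  unfolding ideal_gen_def by (rule module.span_zero[OF module_times])

lemma ideal_gen_add: "F \<in> ideal_gen A \<Longrightarrow> G \<in> ideal_gen A \<Longrightarrow> F + G \<in> ideal_gen A"
  unfolding ideal_gen_def by (rule module.span_add[OF module_times])

lemma ideal_gen_scale: "F \<in> ideal_gen A \<Longrightarrow> G * F \<in> ideal_gen A"
  unfolding ideal_gen_def by (rule module.span_scale[OF module_times])

lemma ideal_gen_sum: "(\<And>i. i \<in> I \<Longrightarrow> f i \<in> ideal_gen A) \<Longrightarrow> (\<Sum>i\<in>I. f i) \<in> ideal_gen A"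
  unfolding ideal_gen_def by (rule module.span_sum[OF module_times])

lemma ideal_gen_induct [consumes 1, case_names zero step]:
  assumes "F \<in> ideal_gen A" "P 0"
    and "\<And>c x y. x \<in> A \<Longrightarrow> P y \<Longrightarrow> P (c * x + y)"
  shows "P F"
  using module.span_induct_alt[OF module_times] assms unfolding ideal_gen_def by blast

text \<open>Expanding both factors into multiples of generators turns the product into a combination
  of products \<open>a * b\<close>; hence an inclusion of an ideal product can be tested on
  generators.\<close>

lemma ideal_gen_mult_subset:
  assumes "\<And>a b. a \<in> A \<Longrightarrow> b \<in> B \<Longrightarrow> a * b \<in> ideal_gen C"
    and "F \<in> ideal_gen A" "G \<in> ideal_gen B"
  shows "F * G \<in> ideal_gen C"
  using assms(2)
proof (induction rule: ideal_gen_induct)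
  case zero
  show ?case by (simp add: ideal_gen_0)
next
  case (step c a F)
  from assms(3) have "a * G \<in> ideal_gen C"
  proof (induction rule: ideal_gen_induct)
    case zero
    show ?case by (simp add: ideal_gen_0)
  next
    case (step d b G)
    have "d * (a * b) + a * G \<in> ideal_gen C"
      by (rule ideal_gen_add[OF ideal_gen_scale[OF assms(1)[OF \<open>a \<in> A\<close> step.hyps]] step.IH])
    then show ?case by (simp add: algebra_simps)
  qed
  then have "c * (a * G) + F * G \<in> ideal_gen C"
    using step.IH by (rule ideal_gen_add[OF ideal_gen_scale])
  then show ?case by (simp add: algebra_simps)
qed

lemma vanishing_ideal_component_vanishes:
  assumes "F \<in> vanishing_ideal \<beta> Y" "torus_orbit \<beta> P \<in> Y"
  shows "eval_poly (graded_component \<beta> \<alpha> F) P = 0"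
  using assms(1) unfolding vanishing_ideal_def
proof (induction rule: ideal_gen_induct)
  case zero
  show ?case by simp
next
  case (step c H F)
  then obtain \<gamma> where "H \<in> graded_piece \<beta> \<gamma>" and "eval_poly H P = 0"
    using assms(2) by (auto simp: homogeneous_def)
  \<comment> \<open>With this shift the degree \<alpha> component of \<open>c * H\<close> is a
    component of \<open>c\<close> times \<open>H\<close>, and \<open>H\<close> vanishes at
    \<open>P\<close>.\<close>
  with graded_component_mult[of H \<beta> \<gamma> "\<alpha> - \<gamma>" c] step show ?case
    by (simp add: graded_component_add)
qed

section \<open>Orbits\<close>

lemma torus_orbit_eqD:
  assumes "torus_orbit \<beta> P = torus_orbit \<beta> Q"
  obtains g where "\<And>i. g $ i \<noteq> 0" "P = g * Q"
proof -
  \<comment> \<open>The identity puts \<open>P\<close> into its own orbit, hence into that of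
    \<open>Q\<close>.\<close>
  have "1 \<in> torus_group \<beta>" by (simp add: torus_group_def)
  then have "1 * P \<in> torus_orbit \<beta> P" unfolding torus_orbit_def by (rule imageI)
  then have "P \<in> torus_orbit \<beta> Q" using assms by simp
  then show ?thesis using that by (auto simp: torus_orbit_def torus_group_def)
qed

text \<open>Scaling coordinates by nonzero factors does not change which of them vanish, and this
  decides whether a monomial vanishes.\<close>

lemma eval_cone_monomial_orbit:
  assumes "torus_orbit \<beta> P = torus_orbit \<beta> Q"
  shows "eval_poly (cone_monomial \<phi> \<sigma>) P = 0 \<longleftrightarrow> eval_poly (cone_monomial \<phi> \<sigma>) Q = 0"
proof -
  obtain g where "\<And>i. g $ i \<noteq> 0" "P = g * Q" using assms by (rule torus_orbit_eqD) blast
  then show ?thesis by (simp add: eval_cone_monomial)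
qed

lemma zero_set_ideal_gen: "zero_set (ideal_gen A) = zero_set A"
proof
  show "zero_set (ideal_gen A) \<subseteq> zero_set A" by (auto simp: zero_set_def ideal_gen_base)
next
  have "eval_poly F P = 0" if "P \<in> zero_set A" "F \<in> ideal_gen A" for P F
    using that(2) by (induction rule: ideal_gen_induct) (use that(1) in \<open>auto simp: zero_set_def\<close>)
  then show "zero_set A \<subseteq> zero_set (ideal_gen A)" by (auto simp: zero_set_def)
qed

text \<open>\<open>P\<close> may be any point of the orbit, rational or not, because
  \<open>vanishing_ideal\<close> tests all of them.\<close>

lemma orbit_in_toric_iff:
  fixes P :: "'f::field alg_closure ^ 'r::finite"
  shows "torus_orbit \<beta> P \<in> toric_rational_points \<Sigma> \<phi> \<beta> \<longleftrightarrow>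
    torus_orbit \<beta> P \<in> affine_orbits \<beta> \<and> (\<exists>\<sigma>\<in>\<Sigma>. eval_poly (cone_monomial \<phi> \<sigma>) P \<noteq> 0)"
proof -
  let ?M = "\<lambda>\<sigma> Q. eval_poly (cone_monomial \<phi> \<sigma>) Q :: 'f alg_closure"
  have Z: "Q \<in> zero_set (irrelevant_ideal \<Sigma> \<phi>) \<longleftrightarrow> (\<forall>\<sigma>\<in>\<Sigma>. ?M \<sigma> Q = 0)" for Q
    unfolding irrelevant_ideal_def zero_set_ideal_gen by (simp add: zero_set_def)
  have "torus_orbit \<beta> P \<in> toric_rational_points \<Sigma> \<phi> \<beta> \<longleftrightarrow>
    (\<exists>Q\<in>rational_points. torus_orbit \<beta> P = torus_orbit \<beta> Q \<and> (\<exists>\<sigma>\<in>\<Sigma>. ?M \<sigma> Q \<noteq> 0))"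
    unfolding toric_rational_points_def image_iff Bex_def Diff_iff Z by blast
  \<comment> \<open>Orbit invariance moves the condition from the rational representative
    \<open>Q\<close> to \<open>P\<close>.\<close>
  also have "\<dots> \<longleftrightarrow>
    (\<exists>Q\<in>rational_points. torus_orbit \<beta> P = torus_orbit \<beta> Q \<and> (\<exists>\<sigma>\<in>\<Sigma>. ?M \<sigma> P \<noteq> 0))"
    by (intro bex_cong refl conj_cong arg_cong[where f = Not] eval_cone_monomial_orbit[of \<beta>]) simp
  also have "\<dots> \<longleftrightarrow> torus_orbit \<beta> P \<in> affine_orbits \<beta> \<and> (\<exists>\<sigma>\<in>\<Sigma>. ?M \<sigma> P \<noteq> 0)"
    unfolding affine_orbits_def image_iff by blast
  finally show ?thesis .
qed

theorem corollary4p2: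
  fixes \<Sigma> :: "(real ^ 'n) set set"
    and \<phi> :: "int ^ 'n ^ 'r"
    and \<beta> :: "int ^ 'r ^ 'd"
  assumes "is_fan \<Sigma>" and "simplicial_fan \<Sigma>" and "complete_fan \<Sigma>"
    and "ray_matrix \<Sigma> \<phi>"
    and "short_exact \<phi> \<beta>"
    and "CARD('r) = CARD('n) + CARD('d)"
    and "rank (\<chi> i j. real_of_int (\<beta> $ i $ j)) = CARD('d)"
    and "\<And>i j. 0 \<le> \<beta> $ i $ j"
  shows "vanishing_ideal \<beta> (toric_rational_points \<Sigma> \<phi> \<beta>) =
         ideal_colon (vanishing_ideal \<beta> (affine_orbits \<beta>))
           (irrelevant_ideal \<Sigma> \<phi> :: ('r, 'f::{field,finite}) mvpoly set)"
    (is "vanishing_ideal \<beta> ?X = ideal_colon (vanishing_ideal \<beta> ?A) ?B")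
proof (intro equalityI subsetI)
  fix F :: "('r, 'f) mvpoly"
  assume F: "F \<in> vanishing_ideal \<beta> ?X"
  have "F * G \<in> vanishing_ideal \<beta> ?A" if G: "G \<in> ?B" for G
  proof -
    \<comment> \<open>At a point of a rational orbit either \<open>M\<close> is zero, or the orbit
      lies in \<open>?X\<close> and \<open>H\<close> is zero.\<close>
    have "H * M \<in> vanishing_ideal \<beta> ?A"
      if "H \<in> {H. homogeneous \<beta> H \<and> (\<forall>P. torus_orbit \<beta> P \<in> ?X \<longrightarrow> eval_poly H P = 0)}"
        and "M \<in> cone_monomial \<phi> ` \<Sigma>" for H M :: "('r, 'f) mvpoly"
      using that unfolding vanishing_ideal_def
      by (intro ideal_gen_base)
         (auto simp: homogeneous_mult homogeneous_cone_monomial orbit_in_toric_iff)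
    then show ?thesis
      using F G unfolding vanishing_ideal_def irrelevant_ideal_def by (rule ideal_gen_mult_subset)
  qed
  then show "F \<in> ideal_colon (vanishing_ideal \<beta> ?A) ?B" by (simp add: ideal_colon_def)
next
  fix F :: "('r, 'f) mvpoly"
  assume F: "F \<in> ideal_colon (vanishing_ideal \<beta> ?A) ?B"
  have "eval_poly (graded_component \<beta> \<alpha> F) P = 0" if X: "torus_orbit \<beta> P \<in> ?X" for \<alpha> P
  proof -
    \<comment> \<open>The cone depends on \<open>P\<close>: its monomial is one that can be
      cancelled at this point.\<close>
    obtain \<sigma> where "\<sigma> \<in> \<Sigma>" and P: "torus_orbit \<beta> P \<in> ?A"
      and nz: "eval_poly (cone_monomial \<phi> \<sigma>) P \<noteq> 0"
      using X by (auto simp: orbit_in_toric_iff)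
    let ?M = "cone_monomial \<phi> \<sigma> :: ('r, 'f) mvpoly"
    obtain \<gamma> where \<gamma>: "?M \<in> graded_piece \<beta> \<gamma>"
      using homogeneous_cone_monomial[of \<beta> \<phi> \<sigma>] unfolding homogeneous_def by blast
    have "F * ?M \<in> vanishing_ideal \<beta> ?A"
      using F \<open>\<sigma> \<in> \<Sigma>\<close> by (auto simp: ideal_colon_def irrelevant_ideal_def ideal_gen_base)
    \<comment> \<open>This component is the degree \<alpha> component of \<open>F\<close> times
      \<open>?M\<close>, and \<open>?M\<close> is nonzero at \<open>P\<close>.\<close>
    then have "eval_poly (graded_component \<beta> (\<alpha> + \<gamma>) (F * ?M)) P = 0"
      using P by (rule vanishing_ideal_component_vanishes)
    with nz show ?thesis by (simp add: graded_component_mult[OF \<gamma>])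
  qed
  then have "graded_component \<beta> \<alpha> F \<in> vanishing_ideal \<beta> ?X" for \<alpha>
    unfolding vanishing_ideal_def homogeneous_def
    using graded_component_in_graded_piece by (intro ideal_gen_base) blast
  then have "(\<Sum>\<alpha>\<in>monom_degree \<beta> ` Poly_Mapping.keys F. graded_component \<beta> \<alpha> F)
      \<in> vanishing_ideal \<beta> ?X"
    unfolding vanishing_ideal_def by (intro ideal_gen_sum)
  then show "F \<in> vanishing_ideal \<beta> ?X" by (simp only: sum_graded_components)
qed

end
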